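(* IKC violates the Richness, Standard Consistency, Refinement Consistency, Inter-edge Consistency, Connectivity, Pair-of-Cliques and Fixed Point axioms.
   Context: A network is a finite simple undirected unweighted graph $N=(V,E)$; a clustering is a partition of $V$ into nonempty clusters; $N[S]$ is the induced subgraph on $S\subseteq V$. For an integer $k\ge0$, the $k$-core of a graph $H$ is the subgraph obtained by repeatedly deleting vertices of degree less than $k$ (in the current subgraph) until none remain, i.e. the maximal induced subgraph of minimum degree at least $k$ (possibly empty). For a set $c$ of vertices of $N$ with $E\ne\emptyset$, its modularity score is $\frac{e_c}{|E|}-\left(\frac{d_c}{2|E|}\right)^2$, where $e_c$ is the number of edges with both endpoints in $c$ and $d_c$ the sum of the degrees in $N$ of the vertices of $c$. IKC (iterative $k$-core, with $k_0=0$): on input $N=(V,E)$, set $R=V$; while $R\neq\emptyset$: let $k$ be the largest integer such that the $k$-core of $N[R]$ is nonempty; for each connected component $c$ of this $k$-core, output $c$ as a cluster if $|c|=1$ or if its modularity score (computed in the input network $N$) is positive, and otherwise output each vertex of $c$ as a singleton cluster; then remove the vertices of the $k$-core from $R$. IKC is a deterministic method; write $M(N)$ for its output. Axioms for a deterministic method $M$: Richness: for every finite $V$ and every partition $\Gamma$ of $V$ (including $\{V\}$) there is $E$ with $M((V,E))=\Gamma$. Standard Consistency: whenever $E'$ is obtained from $E$ by deleting some edges between different clusters of $M(N)$ and/or adding some edges with both endpoints in a common cluster of $M(N)$, $M((V,E'))=M(N)$. Refinement Consistency: for such $E'$, every cluster of $M((V,E'))$ is contained in a cluster of $M(N)$.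 Inter-edge Consistency: whenever $E'$ is obtained from $E$ by only deleting edges between different clusters of $M(N)$, $M((V,E'))=M(N)$. Connectivity: there is a non-negative non-decreasing $f:\mathbb{R}^+\to\mathbb{R}^+$ with $f(x)\to\infty$ such that for every $N$ and every $c\in M(N)$ with $|c|\ge 2$, the minimum number of edges of $N[c]$ whose removal disconnects $N[c]$ is strictly greater than $f(|c|)$. Pair-of-Cliques: a pair-of-cliques component is a connected component with vertex set $A\cup B$, $A\cap B=\emptyset$, $|A|=|B|=n$, $A,B$ cliques, exactly one edge between $A$ and $B$; size $2n$. The axiom holds if there is $n_0$ such that for every $N$ and every pair-of-cliques component of size $\ge n_0$, $A$ and $B$ are clusters of $M(N)$. Fixed Point: for every $N$ and every nonempty $\mathcal{D}\subseteq M(N)$, $M(N[\bigcup\mathcal{D}])=\mathcal{D}$. *)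

theory Defs
  imports Complex_Main "HOL-Library.Disjoint_Sets" "HOL-Library.Infinite_Typeclass"
begin

section \<open>Networks\<close>

type_synonym 'a graph = "'a set \<times> 'a set set"

abbreviation verts :: "'a graph \<Rightarrow> 'a set" where "verts \<equiv> fst"
abbreviation edges :: "'a graph \<Rightarrow> 'a set set" where "edges \<equiv> snd"

definition network :: "'a graph \<Rightarrow> bool" where
  "network N \<longleftrightarrow> finite (verts N) \<and> (\<forall>e\<in>edges N. e \<subseteq> verts N \<and> card e = 2)"

definition induce :: "'a graph \<Rightarrow> 'a set \<Rightarrow> 'a graph" where
  "induce N S = (S, {e \<in> edges N. e \<subseteq> S})"

definition vdegree :: "'a graph \<Rightarrow> 'a \<Rightarrow> nat" where
  "vdegree N v = card {e \<in> edges N. v \<in> e}"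

definition reach :: "'a graph \<Rightarrow> ('a \<times> 'a) set" where
  "reach N = {(x, y). {x, y} \<in> edges N}\<^sup>* \<inter> verts N \<times> verts N"

definition connected_graph :: "'a graph \<Rightarrow> bool" where
  "connected_graph N \<longleftrightarrow> (\<forall>u\<in>verts N. \<forall>v\<in>verts N. (u, v) \<in> reach N)"

definition components :: "'a graph \<Rightarrow> 'a set set" where
  "components N = verts N // reach N"

section \<open>Cores and modularity\<close>

text \<open>
  Vertex sets inducing minimum degree at least \<open>k\<close> are closed under unions, so the union
  below is the greatest of them (lemmas \<open>k_core_min_degree\<close>, \<open>k_core_greatest\<close>);
  lemma \<open>k_core_by_deletion\<close> shows that it is what remains after exhaustively
  deleting vertices of degree less than \<open>k\<close>.
\<close>

definition k_core :: "nat \<Rightarrow> 'a graph \<Rightarrow> 'a graph" where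
  "k_core k H = induce H (\<Union>{S. S \<subseteq> verts H \<and> (\<forall>v\<in>S. k \<le> vdegree (induce H S) v)})"

text \<open>
  For \<open>edges N = {}\<close> the quotients are \<open>0\<close> by the convention \<open>x / 0 = 0\<close>; the algorithm
  consults the score only for connected \<open>c\<close> with at least two vertices, so never in that case.
\<close>

definition modularity :: "'a graph \<Rightarrow> 'a set \<Rightarrow> real" where
  "modularity N c =
     real (card {e \<in> edges N. e \<subseteq> c}) / real (card (edges N))
     - (real (\<Sum>v\<in>c. vdegree N v) / (2 * real (card (edges N))))\<^sup>2"

lemma verts_induce [simp]: "verts (induce N S) = S"
  by (simp add: induce_def)

lemma k_core_subset: "verts (k_core k H) \<subseteq> verts H"
  by (auto simp: k_core_def)

lemma vdegree_induce_mono: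
  assumes "S \<subseteq> T" "finite T"
  shows "vdegree (induce H S) v \<le> vdegree (induce H T) v"
proof -
  have "finite {e \<in> edges (induce H T). v \<in> e}"
    by (rule finite_subset[of _ "Pow T"]) (use assms in \<open>auto simp: induce_def\<close>)
  then show ?thesis
    unfolding vdegree_def by (rule card_mono) (use assms in \<open>auto simp: induce_def\<close>)
qed

lemma k_core_min_degree:
  assumes "finite (verts H)" "v \<in> verts (k_core k H)"
  shows "k \<le> vdegree (k_core k H) v"
proof -
  let ?U = "verts (k_core k H)"
  obtain S where S: "v \<in> S" "S \<subseteq> verts H" "\<forall>v\<in>S. k \<le> vdegree (induce H S) v"
    using assms(2) by (auto simp: k_core_def)
  then have "S \<subseteq> ?U" by (auto simp: k_core_def)
  moreover have "finite ?U" by (rule finite_subset[OF k_core_subset assms(1)])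
  ultimately have "vdegree (induce H S) v \<le> vdegree (induce H ?U) v"
    by (rule vdegree_induce_mono)
  moreover have "induce H ?U = k_core k H" by (simp add: k_core_def)
  ultimately show ?thesis using S(1,3) by fastforce
qed

lemma k_core_greatest:
  assumes "S \<subseteq> verts H" "\<And>v. v \<in> S \<Longrightarrow> k \<le> vdegree (induce H S) v"
  shows "S \<subseteq> verts (k_core k H)"
  using assms by (auto simp: k_core_def)

inductive deletes :: "nat \<Rightarrow> 'a graph \<Rightarrow> 'a set \<Rightarrow> bool" for k H where
  "deletes k H (verts H)"
| "deletes k H S \<Longrightarrow> v \<in> S \<Longrightarrow> vdegree (induce H S) v < k \<Longrightarrow> deletes k H (S - {v})"

lemma k_core_by_deletion:
  assumes "finite (verts H)" "deletes k H S" "\<And>v. v \<in> S \<Longrightarrow> \<not> vdegree (induce H S) v < k"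
  shows "k_core k H = induce H S"
proof -
  let ?U = "verts (k_core k H)"
  have eq: "induce H ?U = k_core k H" by (simp add: k_core_def)
  from assms(2) have "?U \<subseteq> S \<and> S \<subseteq> verts H"
  proof induction
    case 1
    show ?case by (simp add: k_core_subset)
  next
    case (2 S v)
    have "v \<notin> ?U"
    proof
      assume "v \<in> ?U"
      then have "k \<le> vdegree (induce H ?U) v" using k_core_min_degree assms(1) eq by metis
      also have "\<dots> \<le> vdegree (induce H S) v"
        using 2(4) finite_subset[OF _ assms(1)] by (intro vdegree_induce_mono) auto
      finally show False using 2 by simp
    qed
    then show ?case using 2 by blast
  qed
  moreover from this have "S \<subseteq> ?U"
    by (intro k_core_greatest) (use assms(3) in \<open>auto simp: not_less\<close>)
  ultimately show ?thesis using eq by auto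
qed

section \<open>The IKC method\<close>

definition max_core :: "'a graph \<Rightarrow> 'a graph" where
  "max_core H = k_core (GREATEST k. verts (k_core k H) \<noteq> {}) H"

definition emit :: "'a graph \<Rightarrow> 'a set \<Rightarrow> 'a set set" where
  "emit N c = (if card c = 1 \<or> modularity N c > 0 then {c} else {{v} | v. v \<in> c})"

lemma max_core_nonempty:
  assumes "finite (verts H)" "verts H \<noteq> {}"
  shows "verts (max_core H) \<noteq> {}"
  unfolding max_core_def
proof (rule GreatestI_nat)
  show "verts (k_core 0 H) \<noteq> {}"
    using assms(2) k_core_greatest[of "verts H" H 0] by auto
next
  fix k assume "verts (k_core k H) \<noteq> {}"
  then obtain v where v: "v \<in> verts (k_core k H)" by blast
  have "k \<le> card {e \<in> edges (k_core k H). v \<in> e}"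
    using k_core_min_degree[OF assms(1) v] by (simp add: vdegree_def)
  also have "\<dots> \<le> card (Pow (verts H))"
    by (rule card_mono) (use assms(1) in \<open>auto simp: k_core_def induce_def\<close>)
  finally show "k \<le> card (Pow (verts H))" .
qed

lemma max_core_subset: "verts (max_core H) \<subseteq> verts H"
  unfolding max_core_def by (rule k_core_subset)

function ikc_loop :: "'a graph \<Rightarrow> 'a set \<Rightarrow> 'a set set" where
  "ikc_loop N R =
     (if R = {} \<or> infinite R then {}
      else (\<Union>c\<in>components (max_core (induce N R)). emit N c)
           \<union> ikc_loop N (R - verts (max_core (induce N R))))"
  by pat_completeness auto
termination
proof (relation "measure (\<lambda>(N, R). card R)")
  fix N :: "'a graph" and R :: "'a set"
  assume "\<not> (R = {} \<or> infinite R)"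
  then have "R - verts (max_core (induce N R)) \<subset> R" and "finite R"
    using max_core_nonempty[of "induce N R"] max_core_subset[of "induce N R"] by auto
  then show "((N, R - verts (max_core (induce N R))), (N, R)) \<in> measure (\<lambda>(N, R). card R)"
    by (simp add: psubset_card_mono)
qed simp

declare ikc_loop.simps [simp del]

definition IKC :: "'a graph \<Rightarrow> 'a set set" where
  "IKC N = ikc_loop N (verts N)"

lemma equiv_reach: "equiv (verts N) (reach N)"
proof -
  have "sym ({(x, y). {x, y} \<in> edges N}\<^sup>*)"
    by (rule sym_rtrancl) (auto simp: sym_def insert_commute)
  then show ?thesis
    unfolding reach_def
    by (intro equivI refl_onI symI transI) (auto dest: symD intro: rtrancl_trans)
qed

lemma partition_on_emit: "c \<noteq> {} \<Longrightarrow> partition_on c (emit N c)"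
  by (auto simp: emit_def partition_on_def disjoint_def)

lemma partition_on_disjoint_union:
  assumes "partition_on A P" "partition_on B Q" "A \<inter> B = {}"
  shows "partition_on (A \<union> B) (P \<union> Q)"
  unfolding partition_on_def
proof (intro conjI)
  show "disjoint (P \<union> Q)"
    by (rule disjoint_union) (use assms in \<open>simp_all add: partition_on_def\<close>)
qed (use assms in \<open>simp_all add: partition_on_def\<close>)

lemma partition_on_ikc_loop: "finite R \<Longrightarrow> partition_on R (ikc_loop N R)"
proof (induction "card R" arbitrary: R rule: less_induct)
  case less
  show ?case
  proof (cases "R = {}")
    case True
    then show ?thesis using ikc_loop.simps[of N R] by (simp add: partition_on_empty)
  next
    case False
    let ?H = "max_core (induce N R)"
    have ne: "verts ?H \<noteq> {}" and sub: "verts ?H \<subseteq> R"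
      using max_core_nonempty[of "induce N R"] max_core_subset[of "induce N R"] less.prems False
      by auto
    have part: "partition_on (verts ?H) (components ?H)"
      unfolding components_def by (rule partition_on_quotient[OF equiv_reach])
    have em: "partition_on c (emit N c)" if "c \<in> components ?H" for c
      using that part by (intro partition_on_emit) (auto simp: partition_on_def)
    have now: "partition_on (verts ?H) (\<Union>c\<in>components ?H. emit N c)"
    proof (rule partition_onI)
      show "\<Union> (\<Union>c\<in>components ?H. emit N c) = verts ?H"
      proof -
        have "\<Union> (\<Union>c\<in>components ?H. emit N c) = (\<Union>c\<in>components ?H. \<Union> (emit N c))" by blast
        also have "\<dots> = (\<Union>c\<in>components ?H. c)" using em by (auto simp: partition_on_def)
        also have "\<dots> = verts ?H" using part by (simp add: partition_on_def)
        finally show ?thesis .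
      qed
      show "{} \<notin> (\<Union>c\<in>components ?H. emit N c)"
        using em by (auto simp: partition_on_def)
      show "disjnt p q" if pq: "p \<in> (\<Union>c\<in>components ?H. emit N c)"
        "q \<in> (\<Union>c\<in>components ?H. emit N c)" "p \<noteq> q" for p q
      proof -
        obtain c d where cd: "c \<in> components ?H" "p \<in> emit N c" "d \<in> components ?H" "q \<in> emit N d"
          using pq by blast
        have pc: "partition_on c (emit N c)" "partition_on d (emit N d)"
          using cd em by simp_all
        show ?thesis
        proof (cases "c = d")
          case True
          then show ?thesis using pc cd pq(3) unfolding partition_on_def disjoint_def disjnt_def by metis
        next
          case False
          then have "c \<inter> d = {}" using part cd unfolding partition_on_def disjoint_def by metis
          moreover have "p \<subseteq> c" "q \<subseteq> d" using pc cd unfolding partition_on_def by blast+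
          ultimately show ?thesis unfolding disjnt_def by blast
        qed
      qed
    qed
    have "card (R - verts ?H) < card R"
      using ne sub less.prems by (intro psubset_card_mono) auto
    then have "partition_on (R - verts ?H) (ikc_loop N (R - verts ?H))"
      using less by blast
    then have "partition_on (verts ?H \<union> (R - verts ?H))
        ((\<Union>c\<in>components ?H. emit N c) \<union> ikc_loop N (R - verts ?H))"
      by (rule partition_on_disjoint_union[OF now]) blast
    moreover have "verts ?H \<union> (R - verts ?H) = R" using sub by blast
    ultimately show ?thesis
      using False less.prems ikc_loop.simps[of N R] by simp
  qed
qed

lemma partition_on_IKC: "network N \<Longrightarrow> partition_on (verts N) (IKC N)"
  by (simp add: IKC_def network_def partition_on_ikc_loop)

section \<open>Axioms\<close>

definition richness :: "('a graph \<Rightarrow> 'a set set) \<Rightarrow> bool" where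
  "richness M \<longleftrightarrow>
     (\<forall>V \<Gamma>. finite V \<and> partition_on V \<Gamma> \<longrightarrow> (\<exists>E. network (V, E) \<and> M (V, E) = \<Gamma>))"

definition inter_edge :: "'a set set \<Rightarrow> 'a set \<Rightarrow> bool" where
  "inter_edge \<Gamma> e \<longleftrightarrow> (\<exists>u v. e = {u, v} \<and> (\<exists>C\<in>\<Gamma>. \<exists>D\<in>\<Gamma>. C \<noteq> D \<and> u \<in> C \<and> v \<in> D))"

definition intra_edge :: "'a set set \<Rightarrow> 'a set \<Rightarrow> bool" where
  "intra_edge \<Gamma> e \<longleftrightarrow> (\<exists>C\<in>\<Gamma>. e \<subseteq> C)"

definition consistent_change :: "'a set set \<Rightarrow> 'a graph \<Rightarrow> 'a graph \<Rightarrow> bool" where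
  "consistent_change \<Gamma> N N' \<longleftrightarrow> network N' \<and> verts N' = verts N \<and>
     (\<forall>e \<in> edges N - edges N'. inter_edge \<Gamma> e) \<and>
     (\<forall>e \<in> edges N' - edges N. intra_edge \<Gamma> e)"

definition standard_consistency :: "('a graph \<Rightarrow> 'a set set) \<Rightarrow> bool" where
  "standard_consistency M \<longleftrightarrow>
     (\<forall>N N'. network N \<and> consistent_change (M N) N N' \<longrightarrow> M N' = M N)"

definition refinement_consistency :: "('a graph \<Rightarrow> 'a set set) \<Rightarrow> bool" where
  "refinement_consistency M \<longleftrightarrow>
     (\<forall>N N'. network N \<and> consistent_change (M N) N N' \<longrightarrow> (\<forall>C \<in> M N'. \<exists>D \<in> M N. C \<subseteq> D))"

definition inter_edge_consistency :: "('a graph \<Rightarrow> 'a set set) \<Rightarrow> bool" where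
  "inter_edge_consistency M \<longleftrightarrow>
     (\<forall>V E E'. network (V, E) \<and> E' \<subseteq> E \<and> (\<forall>e \<in> E - E'. inter_edge (M (V, E)) e)
        \<longrightarrow> M (V, E') = M (V, E))"

definition min_cut :: "'a graph \<Rightarrow> nat" where
  "min_cut H = (LEAST m. \<exists>F \<subseteq> edges H. card F = m \<and> \<not> connected_graph (verts H, edges H - F))"

definition connectivity :: "('a graph \<Rightarrow> 'a set set) \<Rightarrow> bool" where
  "connectivity M \<longleftrightarrow>
     (\<exists>f :: real \<Rightarrow> real.
        (\<forall>x>0. 0 \<le> f x) \<and> mono_on {0<..} f \<and> filterlim f at_top at_top \<and>
        (\<forall>N. network N \<longrightarrow>
           (\<forall>c \<in> M N. 2 \<le> card c \<longrightarrow> f (real (card c)) < real (min_cut (induce N c)))))"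

definition clique :: "'a graph \<Rightarrow> 'a set \<Rightarrow> bool" where
  "clique N A \<longleftrightarrow> A \<subseteq> verts N \<and> (\<forall>u\<in>A. \<forall>v\<in>A. u \<noteq> v \<longrightarrow> {u, v} \<in> edges N)"

definition pair_of_cliques :: "'a graph \<Rightarrow> 'a set \<Rightarrow> 'a set \<Rightarrow> bool" where
  "pair_of_cliques N A B \<longleftrightarrow>
     A \<union> B \<in> components N \<and> A \<inter> B = {} \<and> card A = card B \<and> clique N A \<and> clique N B \<and>
     card {e \<in> edges N. \<exists>a\<in>A. \<exists>b\<in>B. e = {a, b}} = 1"

definition pair_of_cliques_axiom :: "('a graph \<Rightarrow> 'a set set) \<Rightarrow> bool" where
  "pair_of_cliques_axiom M \<longleftrightarrow>
     (\<exists>n\<^sub>0. \<forall>N A B. network N \<and> pair_of_cliques N A B \<and> n\<^sub>0 \<le> card (A \<union> B) \<longrightarrow>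
        A \<in> M N \<and> B \<in> M N)"

definition fixed_point :: "('a graph \<Rightarrow> 'a set set) \<Rightarrow> bool" where
  "fixed_point M \<longleftrightarrow>
     (\<forall>N \<D>. network N \<and> \<D> \<noteq> {} \<and> \<D> \<subseteq> M N \<longrightarrow> M (induce N (\<Union>\<D>)) = \<D>)"

end

theory Submission
  imports Defs
begin

text \<open>
  A union of connected components containing a fraction \<open>p\<close> of the edges has modularity
  \<open>p - p\<^sup>2\<close>, which vanishes at \<open>p = 1\<close>; hence IKC never outputs a
  nontrivial cluster equal to the whole vertex set, which contradicts Richness. All other axioms
  fail on a single family of networks: two \<open>n\<close>-cliques joined by one edge, together with a
  separate edge \<open>xy\<close>. The joined cliques form the \<open>(n - 1)\<close>-core and, since
  \<open>0 < p < 1\<close>, a cluster. This cluster has a cut of size one and is not split into its two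
  cliques, and restricting the network to it makes its modularity vanish. Finally, the network
  arises by deleting edges from a complete graph, whose IKC clusters are singletons.
\<close>

section \<open>Degrees, components and cores\<close>

lemma network_finite_edges: "network N \<Longrightarrow> finite (edges N)"
  by (rule finite_subset[of _ "Pow (verts N)"]) (auto simp: network_def)

lemma network_induce: "network N \<Longrightarrow> S \<subseteq> verts N \<Longrightarrow> network (induce N S)"
  by (auto simp: network_def induce_def intro: finite_subset)

lemma induce_verts: "network N \<Longrightarrow> induce N (verts N) = N"
  by (cases N) (auto simp: network_def induce_def)

text \<open>Sending \<open>u\<close> to \<open>{u, v}\<close> is a bijection from the neighbours of
  \<open>v\<close> to the edges at \<open>v\<close>, since every edge has exactly two ends.\<close>

lemma vdegree_eq_card_neighbours:
  assumes "network N"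
  shows "vdegree N v = card {u. {u, v} \<in> edges N}"
proof -
  have "{e \<in> edges N. v \<in> e} = (\<lambda>u. {u, v}) ` {u. {u, v} \<in> edges N}"
  proof (intro equalityI subsetI)
    fix e assume e: "e \<in> {e \<in> edges N. v \<in> e}"
    then have "card e = 2" using assms by (auto simp: network_def)
    with e obtain u where "e = {u, v}" by (auto simp: card_2_iff)
    with e show "e \<in> (\<lambda>u. {u, v}) ` {u. {u, v} \<in> edges N}" by auto
  qed auto
  moreover have "inj_on (\<lambda>u. {u, v}) {u. {u, v} \<in> edges N}"
    by (auto simp: inj_on_def doubleton_eq_iff)
  ultimately show ?thesis by (simp add: vdegree_def card_image)
qed

lemma vdegree_induce:
  assumes "network N" "S \<subseteq> verts N" "v \<in> S"
  shows "vdegree (induce N S) v = card {u \<in> S. {u, v} \<in> edges N}"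
proof -
  have "{u. {u, v} \<in> edges (induce N S)} = {u \<in> S. {u, v} \<in> edges N}"
    using assms(3) by (auto simp: induce_def)
  then show ?thesis
    using vdegree_eq_card_neighbours[OF network_induce[OF assms(1,2)]] by simp
qed

text \<open>Double counting of incidences: closedness puts every edge at a vertex of
  \<open>c\<close> inside \<open>c\<close>, and each such edge is counted once at each of its two
  ends.\<close>

lemma sum_vdegree_closed:
  assumes "network N" "c \<subseteq> verts N" "\<And>e. e \<in> edges N \<Longrightarrow> e \<inter> c \<noteq> {} \<Longrightarrow> e \<subseteq> c"
  shows "(\<Sum>v\<in>c. vdegree N v) = 2 * card {e \<in> edges N. e \<subseteq> c}"
proof -
  have fin: "finite c" using assms(1,2) by (auto simp: network_def intro: finite_subset)
  have "card {i \<in> c. i \<in> e} = 2" if "e \<in> {e \<in> edges N. e \<subseteq> c}" for e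
  proof -
    have "{i \<in> c. i \<in> e} = e" using that by auto
    then show ?thesis using that assms(1) by (auto simp: network_def)
  qed
  then have "(\<Sum>v\<in>c. card {e \<in> {e \<in> edges N. e \<subseteq> c}. v \<in> e}) = (\<Sum>e\<in>{e \<in> edges N. e \<subseteq> c}. 2)"
    using fin network_finite_edges[OF assms(1)] by (intro sum_multicount_gen) auto
  moreover have "{e \<in> {e \<in> edges N. e \<subseteq> c}. v \<in> e} = {e \<in> edges N. v \<in> e}" if "v \<in> c" for v
    using that assms(3) by blast
  ultimately show ?thesis by (simp add: vdegree_def)
qed

text \<open>By the handshake count the degree term is \<open>2 * e / (2 * m)\<close>, so it equals
  the edge fraction \<open>p\<close> and only its square is subtracted.\<close>

lemma modularity_closed:
  assumes "network N" "c \<subseteq> verts N" "\<And>e. e \<in> edges N \<Longrightarrow> e \<inter> c \<noteq> {} \<Longrightarrow> e \<subseteq> c"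
  defines "p \<equiv> real (card {e \<in> edges N. e \<subseteq> c}) / real (card (edges N))"
  shows "modularity N c = p - p\<^sup>2"
proof -
  have "real (\<Sum>v\<in>c. vdegree N v) = 2 * real (card {e \<in> edges N. e \<subseteq> c})"
    using sum_vdegree_closed[OF assms(1-3)] by simp
  then show ?thesis unfolding modularity_def p_def by (simp only: mult_divide_mult_cancel_left_if) simp
qed

lemma modularity_verts:
  assumes "network N"
  shows "modularity N (verts N) = 0"
proof -
  have *: "{e \<in> edges N. e \<subseteq> verts N} = edges N" using assms by (auto simp: network_def)
  have "modularity N (verts N) = real (card (edges N)) / real (card (edges N))
      - (real (card (edges N)) / real (card (edges N)))\<^sup>2"
    using modularity_closed[of N "verts N"] assms * by (auto simp: network_def)
  \<comment> \<open>With no edges the quotients are \<open>0\<close> by convention, otherwise they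
    are \<open>1\<close>; the difference vanishes in both cases.\<close>
  then show ?thesis by (cases "card (edges N) = 0") auto
qed

text \<open>The inner edge \<open>e\<close> gives \<open>0 < p\<close> and the outer edge
  \<open>e'\<close> gives \<open>p < 1\<close>, so \<open>p * (1 - p)\<close> is positive.\<close>

lemma modularity_closed_pos:
  assumes "network N" "c \<subseteq> verts N" "\<And>e. e \<in> edges N \<Longrightarrow> e \<inter> c \<noteq> {} \<Longrightarrow> e \<subseteq> c"
    and "e \<in> edges N" "e \<subseteq> c" "e' \<in> edges N" "\<not> e' \<subseteq> c"
  shows "modularity N c > 0"
proof -
  let ?I = "{e \<in> edges N. e \<subseteq> c}"
  define p where "p = real (card ?I) / real (card (edges N))"
  have fin: "finite (edges N)" by (rule network_finite_edges[OF assms(1)])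
  have "card ?I < card (edges N)"
    by (rule psubset_card_mono[OF fin]) (use assms(6,7) in auto)
  moreover have "card ?I > 0" using fin assms(4,5) by (auto simp: card_gt_0_iff)
  ultimately have "0 < p" "p < 1" by (auto simp: p_def)
  then have "0 < p * (1 - p)" by simp
  then show ?thesis
    using modularity_closed[OF assms(1-3)] by (simp add: p_def power2_eq_square algebra_simps)
qed

text \<open>Closedness keeps paths starting at \<open>r\<close> inside \<open>c\<close>, and every
  vertex of \<open>c\<close> is reached, so \<open>c\<close> is the class of
  \<open>r\<close>.\<close>

lemma componentsI:
  assumes "r \<in> c" "c \<subseteq> verts N" "\<And>e. e \<in> edges N \<Longrightarrow> e \<inter> c \<noteq> {} \<Longrightarrow> e \<subseteq> c"
    and "\<And>v. v \<in> c \<Longrightarrow> (r, v) \<in> {(x, y). {x, y} \<in> edges N}\<^sup>*"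
  shows "c \<in> components N"
proof -
  have "v \<in> c" if "(r, v) \<in> {(x, y). {x, y} \<in> edges N}\<^sup>*" for v
    using that
  proof induction
    case (step y z)
    then show ?case using assms(3)[of "{y, z}"] by auto
  qed (rule assms(1))
  then have "c = reach N `` {r}" using assms by (auto simp: reach_def)
  then show ?thesis using assms(1,2) by (auto simp: components_def quotient_def)
qed

text \<open>Reduces \<open>GREATEST\<close> and the union in \<open>k_core\<close> to degree
  conditions: \<open>S\<close> is the greatest set of minimum degree \<open>k\<close>, and no
  nonempty set reaches \<open>Suc k\<close>.\<close>

lemma max_core_eqI:
  assumes "finite (verts H)" "S \<subseteq> verts H" "S \<noteq> {}"
    and "\<And>v. v \<in> S \<Longrightarrow> k \<le> vdegree (induce H S) v"
    and "\<And>T. T \<subseteq> verts H \<Longrightarrow> (\<And>v. v \<in> T \<Longrightarrow> k \<le> vdegree (induce H T) v) \<Longrightarrow> T \<subseteq> S"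
    and "\<And>T. T \<subseteq> verts H \<Longrightarrow> (\<And>v. v \<in> T \<Longrightarrow> Suc k \<le> vdegree (induce H T) v) \<Longrightarrow> T = {}"
  shows "max_core H = induce H S"
proof -
  have core: "k_core k H = induce H S"
  proof -
    have "\<Union>{S. S \<subseteq> verts H \<and> (\<forall>v\<in>S. k \<le> vdegree (induce H S) v)} = S"
      using assms(2,4,5) by blast
    then show ?thesis by (simp add: k_core_def)
  qed
  have "(GREATEST j. verts (k_core j H) \<noteq> {}) = k"
  proof (rule Greatest_equality)
    show "verts (k_core k H) \<noteq> {}" using core assms(3) by simp
  next
    fix j assume ne: "verts (k_core j H) \<noteq> {}"
    show "j \<le> k"
    proof (rule ccontr)
      assume "\<not> j \<le> k"
      moreover have "induce H (verts (k_core j H)) = k_core j H" by (simp add: k_core_def)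
      \<comment> \<open>For \<open>j > k\<close> the core has minimum degree at least
        \<open>Suc k\<close>, which the last premise allows only for the empty set.\<close>
      ultimately have "verts (k_core j H) = {}"
        using k_core_min_degree[OF assms(1), of _ j]
        by (intro assms(6) k_core_subset) fastforce
      with ne show False by simp
    qed
  qed
  with core show ?thesis by (simp add: max_core_def)
qed

section \<open>Clusters of IKC\<close>

text \<open>In every round, clusters enter through \<open>emit\<close>, which either checks this
  condition or splits into singletons.\<close>

lemma ikc_loop_cluster:
  "c \<in> ikc_loop N R \<Longrightarrow> card c = 1 \<or> modularity N c > 0"
proof (induction N R rule: ikc_loop.induct)
  case (1 N R)
  then show ?case
    by (subst (asm) (2) ikc_loop.simps) (auto simp: emit_def split: if_splits)
qed

lemma IKC_cluster: "c \<in> IKC N \<Longrightarrow> card c = 1 \<or> modularity N c > 0"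
  unfolding IKC_def by (rule ikc_loop_cluster)

lemma verts_notin_IKC: "network N \<Longrightarrow> card (verts N) \<noteq> 1 \<Longrightarrow> verts N \<notin> IKC N"
  using IKC_cluster[of "verts N" N] modularity_verts[of N] by auto

text \<open>The first round works on all of \<open>N\<close>, and later rounds only add
  clusters.\<close>

lemma emit_subset_IKC:
  assumes "network N" "c \<in> components (max_core N)"
  shows "emit N c \<subseteq> IKC N"
proof -
  have "verts (max_core N) \<noteq> {}"
    using assms(2) by (auto simp: components_def quotient_def)
  then have "verts N \<noteq> {}" "finite (verts N)"
    using max_core_subset[of N] assms(1) by (auto simp: network_def)
  then show ?thesis
    unfolding IKC_def using assms
    by (subst ikc_loop.simps) (auto simp: induce_verts)
qed

section \<open>Complete networks\<close>

abbreviation complete_edges :: "'a set \<Rightarrow> 'a set set" where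
  "complete_edges V \<equiv> {e. e \<subseteq> V \<and> card e = 2}"

lemma doubleton_in_complete_edges: "{u, v} \<in> complete_edges V \<longleftrightarrow> u \<in> V \<and> v \<in> V \<and> u \<noteq> v"
  by (auto simp: card_2_iff doubleton_eq_iff)

text \<open>A complete network is its own top core and is connected, so \<open>V\<close> is tested
  as a whole; its modularity is \<open>0\<close>, hence it is split. For \<open>card V = 1\<close>
  the set \<open>V\<close> is already the singleton.\<close>

lemma IKC_complete:
  assumes "finite V" "v \<in> V"
  shows "{v} \<in> IKC (V, complete_edges V)"
proof -
  let ?N = "(V, complete_edges V)"
  have net: "network ?N" using assms(1) by (auto simp: network_def)
  have deg: "vdegree (induce ?N T) u = card T - 1" if "T \<subseteq> V" "u \<in> T" for T u
  proof -
    have "{w \<in> T. {w, u} \<in> edges ?N} = T - {u}"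
      using that by (auto simp: doubleton_in_complete_edges[simplified])
    then show ?thesis
      using vdegree_induce[OF net, of T u] that assms(1)
      by (simp add: card_Diff_singleton)
  qed
  have "max_core ?N = induce ?N V"
  proof (rule max_core_eqI[where k = "card V - 1"])
    fix T assume T: "T \<subseteq> verts ?N" "\<And>u. u \<in> T \<Longrightarrow> Suc (card V - 1) \<le> vdegree (induce ?N T) u"
    have "card T \<le> card V" using T(1) assms(1) by (simp add: card_mono)
    \<comment> \<open>A vertex of \<open>T\<close> would have degree \<open>card T - 1\<close>,
      which is at most \<open>card V - 1\<close>.\<close>
    then show "T = {}" using T deg[of T] by fastforce
  qed (use assms deg in auto)
  then have core: "max_core ?N = ?N" using induce_verts[OF net] by simp
  have "V \<in> components ?N"
  proof (rule componentsI[where r = v])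
    fix u assume "u \<in> V"
    then show "(v, u) \<in> {(x, y). {x, y} \<in> edges ?N}\<^sup>*"
      using assms(2) doubleton_in_complete_edges[of v u V] by (cases "u = v") auto
  qed (use assms in auto)
  then have "emit ?N V \<subseteq> IKC ?N" using emit_subset_IKC[OF net] core by simp
  moreover have "{v} \<in> emit ?N V"
    using modularity_verts[OF net] assms(2) by (auto simp: emit_def card_1_singleton_iff)
  ultimately show ?thesis by blast
qed

section \<open>Two joined cliques and a separate edge\<close>

text \<open>The bound \<open>3 \<le> n\<close> makes \<open>n - 1\<close> exceed the degree of
  \<open>x\<close> and \<open>y\<close>, and \<open>n\<close> exceed the size of
  \<open>{a, b}\<close>; both matter for the top core.\<close>

locale joined_cliques =
  fixes A B :: "'a set" and a b x y :: 'a and n :: nat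
  assumes fin: "finite A" "finite B" and card_AB: "card A = n" "card B = n" and n: "3 \<le> n"
    and disj: "A \<inter> B = {}" and aA: "a \<in> A" and bB: "b \<in> B"
    and xy: "x \<notin> A \<union> B" "y \<notin> A \<union> B" "x \<noteq> y"
begin

definition "V = A \<union> B \<union> {x, y}"
definition "E = complete_edges A \<union> complete_edges B \<union> {{a, b}, {x, y}}"

lemma ab: "a \<noteq> b" using aA bB disj by auto

lemma finite_V: "finite V" using fin by (simp add: V_def)

lemma network: "network (V, E)"
  using finite_V ab xy aA bB by (auto simp: network_def V_def E_def)

lemma doubleton_in_E: "{u, v} \<in> E \<longleftrightarrow> u \<noteq> v \<and> (u \<in> A \<and> v \<in> A \<or> u \<in> B \<and> v \<in> B \<or>
    {u, v} = {a, b} \<or> {u, v} = {x, y})"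
  using ab xy unfolding E_def Un_iff doubleton_in_complete_edges
  by (auto simp: doubleton_eq_iff)

lemma closed: "e \<in> E \<Longrightarrow> e \<inter> (A \<union> B) \<noteq> {} \<Longrightarrow> e \<subseteq> A \<union> B"
  using aA bB xy by (auto simp: E_def)

text \<open>A path goes directly inside \<open>A\<close>, or over the bridge to \<open>b\<close> and
  then inside \<open>B\<close>. The edge set \<open>F\<close> is a parameter so that the full
  network and its restriction to \<open>A \<union> B\<close> are both covered.\<close>

lemma a_reaches:
  assumes "v \<in> A \<union> B" "{e \<in> E. e \<subseteq> A \<union> B} \<subseteq> F"
  shows "(a, v) \<in> {(x, y). {x, y} \<in> F}\<^sup>*"
proof -
  let ?R = "{(x, y). {x, y} \<in> F}"
  have R: "(u, v) \<in> ?R" if "{u, v} \<in> E" "u \<in> A \<union> B" "v \<in> A \<union> B" for u v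
    using that assms(2) by auto
  have ab': "(a, b) \<in> ?R" using R[of a b] doubleton_in_E[of a b] ab aA bB by auto
  show ?thesis
  proof (cases "v \<in> A")
    case True
    then show ?thesis using R[of a v] doubleton_in_E[of a v] aA by (cases "v = a") auto
  next
    case False
    then have "(b, v) \<in> ?R\<^sup>*"
      using assms(1) R[of b v] doubleton_in_E[of b v] bB by (cases "v = b") auto
    with ab' show ?thesis by (rule converse_rtrancl_into_rtrancl)
  qed
qed

lemma component: "A \<union> B \<in> components (V, E)"
proof (rule componentsI[where r = a])
  show "(a, v) \<in> {(x, y). {x, y} \<in> edges (V, E)}\<^sup>*" if "v \<in> A \<union> B" for v
    using that by (intro a_reaches) auto
qed (use aA closed in \<open>auto simp: V_def\<close>)

section \<open>Degrees and the top core\<close>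

lemma degree_clique:
  assumes "C = A \<or> C = B" "v \<in> C"
  shows "n - 1 \<le> vdegree (induce (V, E) (A \<union> B)) v"
proof -
  have "C - {v} \<subseteq> {u \<in> A \<union> B. {u, v} \<in> edges (V, E)}"
    using assms by (auto simp: doubleton_in_E)
  then have "card (C - {v}) \<le> card {u \<in> A \<union> B. {u, v} \<in> edges (V, E)}"
    by (rule card_mono[rotated]) (use fin in auto)
  moreover have "card (C - {v}) = n - 1"
    using assms card_AB fin by (auto simp: card_Diff_singleton)
  moreover have "A \<union> B \<subseteq> verts (V, E)" "v \<in> A \<union> B" using assms by (auto simp: V_def)
  ultimately show ?thesis using vdegree_induce[OF network, of "A \<union> B" v] by simp
qed

lemma degree_le:
  assumes "T \<subseteq> V" "v \<in> T" "finite S" "\<And>u. u \<in> T \<Longrightarrow> {u, v} \<in> E \<Longrightarrow> u \<in> S"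
  shows "vdegree (induce (V, E) T) v \<le> card S"
  using vdegree_induce[OF network, of T v] assms by (auto intro: card_mono)

text \<open>Each clique vertex has the \<open>n - 1\<close> other members of its clique as
  neighbours, while \<open>x\<close> and \<open>y\<close> see only each other and fall out at this
  level.\<close>

lemma max_core: "max_core (V, E) = induce (V, E) (A \<union> B)"
proof (rule max_core_eqI[where k = "n - 1"])
  show "n - 1 \<le> vdegree (induce (V, E) (A \<union> B)) v" if "v \<in> A \<union> B" for v
    using that degree_clique by blast
next
  fix T assume "T \<subseteq> verts (V, E)"
    and deg: "\<And>v. v \<in> T \<Longrightarrow> n - 1 \<le> vdegree (induce (V, E) T) v"
  then have T: "T \<subseteq> V" by simp
  have "x \<notin> T"
  proof
    assume "x \<in> T"
    then have "vdegree (induce (V, E) T) x \<le> card {y}"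
      using xy aA bB by (intro degree_le T) (auto simp: doubleton_in_E doubleton_eq_iff)
    then show False using deg[OF \<open>x \<in> T\<close>] n by simp
  qed
  moreover have "y \<notin> T"
  proof
    assume "y \<in> T"
    then have "vdegree (induce (V, E) T) y \<le> card {x}"
      using xy aA bB by (intro degree_le T) (auto simp: doubleton_in_E doubleton_eq_iff)
    then show False using deg[OF \<open>y \<in> T\<close>] n by simp
  qed
  ultimately show "T \<subseteq> A \<union> B" using T by (auto simp: V_def)
next
  fix T assume "T \<subseteq> verts (V, E)"
    and "\<And>v. v \<in> T \<Longrightarrow> Suc (n - 1) \<le> vdegree (induce (V, E) T) v"
  then have T: "T \<subseteq> V" and deg: "\<And>v. v \<in> T \<Longrightarrow> n \<le> vdegree (induce (V, E) T) v"
    using n by auto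
  \<comment> \<open>Only the ends of the bridge have degree \<open>n\<close>, and they alone do not support it.\<close>
  have sub: "T \<subseteq> {a, b}"
  proof
    fix v assume v: "v \<in> T"
    show "v \<in> {a, b}"
    proof (rule ccontr)
      assume ne: "v \<notin> {a, b}"
      have "vdegree (induce (V, E) T) v \<le> n - 1"
      proof -
        consider "v \<in> A" | "v \<in> B" | "v = x" | "v = y" using v T by (auto simp: V_def)
        then show ?thesis
        proof cases
          case 1
          then have "vdegree (induce (V, E) T) v \<le> card (A - {v})"
            using ne xy fin disj by (intro degree_le T v) (auto simp: doubleton_in_E doubleton_eq_iff)
          then show ?thesis using 1 card_AB fin by (simp add: card_Diff_singleton)
        next
          case 2
          then have "vdegree (induce (V, E) T) v \<le> card (B - {v})"
            using ne xy fin disj by (intro degree_le T v) (auto simp: doubleton_in_E doubleton_eq_iff)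
          then show ?thesis using 2 card_AB fin by (simp add: card_Diff_singleton)
        next
          case 3
          then have "vdegree (induce (V, E) T) v \<le> card {y}"
            using ne xy by (intro degree_le T v) (auto simp: doubleton_in_E doubleton_eq_iff)
          then show ?thesis using n by simp
        next
          case 4
          then have "vdegree (induce (V, E) T) v \<le> card {x}"
            using ne xy by (intro degree_le T v) (auto simp: doubleton_in_E doubleton_eq_iff)
          then show ?thesis using n by simp
        qed
      qed
      then show False using deg[OF v] n by simp
    qed
  qed
  show "T = {}"
  proof (rule ccontr)
    assume "T \<noteq> {}"
    then obtain v where v: "v \<in> T" by blast
    \<comment> \<open>All neighbours within \<open>T\<close> lie in \<open>{a, b}\<close>, so the
      degree is at most \<open>2\<close>, below \<open>n\<close>.\<close>
    have "vdegree (induce (V, E) T) v \<le> card {a, b}"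
      using sub by (intro degree_le T v) auto
    then show False using deg[OF v] n ab by simp
  qed
qed (use aA finite_V in \<open>auto simp: V_def\<close>)

text \<open>The bridge \<open>{a, b}\<close> lies inside the component and \<open>{x, y}\<close>
  outside, which makes the modularity positive.\<close>

lemma cluster: "A \<union> B \<in> IKC (V, E)"
proof -
  have "A \<union> B \<in> components (max_core (V, E))"
    unfolding max_core
  proof (rule componentsI[where r = a])
    show "(a, v) \<in> {(x, y). {x, y} \<in> edges (induce (V, E) (A \<union> B))}\<^sup>*" if "v \<in> A \<union> B" for v
      using that by (intro a_reaches) (auto simp: induce_def)
  qed (use aA in \<open>auto simp: induce_def\<close>)
  moreover have "modularity (V, E) (A \<union> B) > 0"
    by (rule modularity_closed_pos[OF network, where e = "{a, b}" and e' = "{x, y}"])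
      (use aA bB xy closed in \<open>auto simp: V_def E_def\<close>)
  ultimately show ?thesis
    using emit_subset_IKC[OF network, of "A \<union> B"] by (simp add: emit_def)
qed

lemma card_cluster: "card (A \<union> B) = 2 * n"
  using card_AB fin disj by (simp add: card_Un_disjoint)

lemma pair_of_cliques: "pair_of_cliques (V, E) A B"
proof -
  have "{e \<in> E. \<exists>u\<in>A. \<exists>v\<in>B. e = {u, v}} = {{a, b}}"
    using disj xy aA bB ab by (auto simp: doubleton_in_E doubleton_eq_iff)
  then show ?thesis
    using component disj card_AB
    by (auto simp: pair_of_cliques_def clique_def V_def doubleton_in_E)
qed

text \<open>Clusters are disjoint, and \<open>A\<close> is a nonempty proper part of the cluster
  \<open>A \<union> B\<close>.\<close>

lemma clique_not_cluster: "A \<notin> IKC (V, E)"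
proof
  assume "A \<in> IKC (V, E)"
  moreover have "A \<noteq> A \<union> B" using bB disj by auto
  ultimately have "A \<inter> (A \<union> B) = {}"
    by (intro disjointD[OF partition_onD2[OF partition_on_IKC[OF network]] _ cluster])
  with aA show False by auto
qed

text \<open>Once the bridge is removed, paths from \<open>a\<close> cannot leave \<open>A\<close>,
  so \<open>b\<close> is cut off.\<close>

lemma min_cut_le: "min_cut (induce (V, E) (A \<union> B)) \<le> 1"
  unfolding min_cut_def
proof (rule Least_le, intro exI conjI)
  let ?H = "induce (V, E) (A \<union> B)" and ?F = "{{a, b}}"
  show "?F \<subseteq> edges ?H" using aA bB by (auto simp: induce_def E_def)
  show "card ?F = 1" by simp
  have "v \<in> A" if "(a, v) \<in> {(x, y). {x, y} \<in> edges ?H - ?F}\<^sup>*" for v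
    using that
  proof induction
    case (step u v)
    then have "{u, v} \<in> E" "{u, v} \<subseteq> A \<union> B" "{u, v} \<noteq> {a, b}" by (auto simp: induce_def)
    then show ?case using step.IH disj xy by (auto simp: doubleton_in_E doubleton_eq_iff)
  qed (rule aA)
  then have "(a, b) \<notin> reach (verts ?H, edges ?H - ?F)"
    using bB disj by (auto simp: reach_def)
  then show "\<not> connected_graph (verts ?H, edges ?H - ?F)"
    unfolding connected_graph_def using aA bB by (metis UnCI fst_conv verts_induce)
qed

text \<open>After the restriction \<open>A \<union> B\<close> is the entire vertex set, so its
  modularity drops to \<open>0\<close>.\<close>

lemma IKC_restricted: "IKC (induce (V, E) (A \<union> B)) \<noteq> {A \<union> B}"
proof -
  have "network (induce (V, E) (A \<union> B))"
    by (rule network_induce[OF network]) (auto simp: V_def)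
  then have "A \<union> B \<notin> IKC (induce (V, E) (A \<union> B))"
    using verts_notin_IKC[of "induce (V, E) (A \<union> B)"] card_cluster n by simp
  then show ?thesis by blast
qed

section \<open>Comparison with the complete network on the same vertices\<close>

lemma subset_complete: "E \<subseteq> complete_edges V"
  using network by (auto simp: network_def)

text \<open>All clusters of the complete network are singletons, so the consistency axioms permit
  deleting any of its edges.\<close>

lemma complete_inter_edge:
  assumes "e \<in> complete_edges V"
  shows "inter_edge (IKC (V, complete_edges V)) e"
proof -
  obtain u v where e: "e = {u, v}" "u \<noteq> v" "u \<in> V" "v \<in> V"
    using assms by (auto simp: card_2_iff)
  then have uv: "{u} \<in> IKC (V, complete_edges V)" "{v} \<in> IKC (V, complete_edges V)"
    using IKC_complete[OF finite_V] by auto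
  show ?thesis
    unfolding inter_edge_def
    by (rule exI[of _ u], rule exI[of _ v], intro conjI bexI[OF _ uv(1)] bexI[OF _ uv(2)])
      (use e in auto)
qed

text \<open>A cluster containing \<open>a\<close> must be \<open>{a}\<close> by disjointness, and
  this misses \<open>b\<close>.\<close>

lemma cluster_not_in_complete:
  assumes "D \<in> IKC (V, complete_edges V)"
  shows "\<not> A \<union> B \<subseteq> D"
proof
  assume sub: "A \<union> B \<subseteq> D"
  have "network (V, complete_edges V)" using finite_V by (auto simp: network_def)
  then have "disjoint (IKC (V, complete_edges V))"
    using partition_on_IKC by (auto simp: partition_on_def)
  moreover have "{a} \<in> IKC (V, complete_edges V)"
    using IKC_complete[OF finite_V] aA by (auto simp: V_def)
  ultimately have "D = {a}" using assms sub aA disjointD[of _ D "{a}"] by auto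
  with sub bB ab show False by auto
qed

end

text \<open>An infinite vertex type always supplies fresh vertices outside the finite sets chosen so
  far.\<close>

lemma ex_joined_cliques:
  assumes "3 \<le> n"
  shows "\<exists>(A :: 'a::infinite set) B a b x y. joined_cliques A B a b x y n"
proof -
  have inf: "infinite (UNIV :: 'a set)" by (rule infinite_UNIV)
  obtain A :: "'a set" where A: "finite A" "card A = n"
    using infinite_arbitrarily_large[OF inf] by blast
  obtain B where B: "finite B" "card B = n" "B \<subseteq> UNIV - A"
    using infinite_arbitrarily_large[of "UNIV - A" n] inf A(1) by auto
  obtain x where x: "x \<notin> A \<union> B" using ex_new_if_finite[OF inf] A B by blast
  obtain y where y: "y \<notin> insert x (A \<union> B)"
    using ex_new_if_finite[OF inf, of "insert x (A \<union> B)"] A B by blast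
  obtain a b where "a \<in> A" "b \<in> B" using A B assms by fastforce
  then have "joined_cliques A B a b x y n"
    using A B x y assms by unfold_locales auto
  then show ?thesis by blast
qed

theorem theorem5:
  shows "\<not> richness (IKC :: 'a::infinite graph \<Rightarrow> 'a set set)
    \<and> \<not> standard_consistency (IKC :: 'a::infinite graph \<Rightarrow> 'a set set)
    \<and> \<not> refinement_consistency (IKC :: 'a::infinite graph \<Rightarrow> 'a set set)
    \<and> \<not> inter_edge_consistency (IKC :: 'a::infinite graph \<Rightarrow> 'a set set)
    \<and> \<not> connectivity (IKC :: 'a::infinite graph \<Rightarrow> 'a set set)
    \<and> \<not> pair_of_cliques_axiom (IKC :: 'a::infinite graph \<Rightarrow> 'a set set)
    \<and> \<not> fixed_point (IKC :: 'a::infinite graph \<Rightarrow> 'a set set)"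
proof -
  obtain A B :: "'a set" and a b x y where "joined_cliques A B a b x y 3"
    using ex_joined_cliques[of 3] by auto
  then interpret J: joined_cliques A B a b x y 3 .
  let ?V = "J.V" and ?E = "J.E"
  let ?K = "(?V, complete_edges ?V)"
  have netK: "network ?K" using J.finite_V by (auto simp: network_def)
  \<comment> \<open>Passing from \<open>?K\<close> to \<open>(?V, ?E)\<close> only deletes edges,
    all between different singletons, so one pair of networks serves all three consistency
    axioms.\<close>
  have change: "consistent_change (IKC ?K) ?K (?V, ?E)"
    using J.network J.subset_complete J.complete_inter_edge by (auto simp: consistent_change_def)
  have neq: "IKC (?V, ?E) \<noteq> IKC ?K"
    using J.cluster J.cluster_not_in_complete by blast
  have "\<not> richness (IKC :: 'a graph \<Rightarrow> 'a set set)"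
  proof
    assume "richness (IKC :: 'a graph \<Rightarrow> 'a set set)"
    \<comment> \<open>A two-point set with the one-block partition is enough: whatever the edges,
      the whole set is never a cluster.\<close>
    moreover have "partition_on {x, y} {{x, y}}" by (auto simp: partition_on_def)
    ultimately obtain F where "network ({x, y}, F)" "IKC ({x, y}, F) = {{x, y}}"
      unfolding richness_def by (meson finite.emptyI finite.insertI)
    then show False using verts_notin_IKC[of "({x, y}, F)"] J.xy by simp
  qed
  moreover have "\<not> standard_consistency (IKC :: 'a graph \<Rightarrow> 'a set set)"
    using netK change neq unfolding standard_consistency_def by blast
  moreover have "\<not> refinement_consistency (IKC :: 'a graph \<Rightarrow> 'a set set)"
    using netK change J.cluster J.cluster_not_in_complete
    unfolding refinement_consistency_def by blast
  moreover have "\<not> inter_edge_consistency (IKC :: 'a graph \<Rightarrow> 'a set set)"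
    using netK J.subset_complete J.complete_inter_edge neq
    unfolding inter_edge_consistency_def by blast
  moreover have "\<not> connectivity (IKC :: 'a graph \<Rightarrow> 'a set set)"
  proof
    assume "connectivity (IKC :: 'a graph \<Rightarrow> 'a set set)"
    then obtain f :: "real \<Rightarrow> real" where lim: "filterlim f at_top at_top"
      and f: "\<And>N c. network N \<Longrightarrow> c \<in> IKC (N :: 'a graph) \<Longrightarrow> 2 \<le> card c \<Longrightarrow>
        f (real (card c)) < real (min_cut (induce N c))"
      unfolding connectivity_def by blast
    from lim have "eventually (\<lambda>t. 1 \<le> f t) at_top" by (simp add: filterlim_at_top)
    then obtain t where t: "\<And>s. t \<le> s \<Longrightarrow> 1 \<le> f s" by (auto simp: eventually_at_top_linorder)
    \<comment> \<open>The cluster then has size \<open>2 * n\<close>, at least \<open>t\<close>, so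
      \<open>f\<close> is at least \<open>1\<close> there, whereas a cut of size at most
      \<open>1\<close> forces \<open>f\<close> below \<open>1\<close>.\<close>
    define n where "n = max 3 (nat \<lceil>t\<rceil>)"
    obtain A B :: "'a set" and a b x y where "joined_cliques A B a b x y n"
      using ex_joined_cliques[of n] by (auto simp: n_def)
    then interpret L: joined_cliques A B a b x y n .
    have "f (real (card (A \<union> B))) < 1"
      using f[OF L.network L.cluster] L.min_cut_le L.card_cluster L.n by linarith
    moreover have "t \<le> real (card (A \<union> B))"
      unfolding L.card_cluster n_def by linarith
    ultimately show False using t by fastforce
  qed
  moreover have "\<not> pair_of_cliques_axiom (IKC :: 'a graph \<Rightarrow> 'a set set)"
  proof
    assume "pair_of_cliques_axiom (IKC :: 'a graph \<Rightarrow> 'a set set)"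
    then obtain m where m: "\<And>N A B. network N \<Longrightarrow> pair_of_cliques (N :: 'a graph) A B \<Longrightarrow>
        m \<le> card (A \<union> B) \<Longrightarrow> A \<in> IKC N"
      unfolding pair_of_cliques_axiom_def by blast
    \<comment> \<open>The size is taken past the threshold \<open>m\<close> that the axiom
      claims.\<close>
    obtain A B :: "'a set" and a b x y where "joined_cliques A B a b x y (max 3 m)"
      using ex_joined_cliques[of "max 3 m"] by auto
    then interpret L: joined_cliques A B a b x y "max 3 m" .
    have "m \<le> card (A \<union> B)" unfolding L.card_cluster by simp
    then show False using m[OF L.network L.pair_of_cliques] L.clique_not_cluster by blast
  qed
  moreover have "\<not> fixed_point (IKC :: 'a graph \<Rightarrow> 'a set set)"
  proof
    assume "fixed_point (IKC :: 'a graph \<Rightarrow> 'a set set)"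
    then have "IKC (induce (?V, ?E) (\<Union>{A \<union> B})) = {A \<union> B}"
      using J.network J.cluster unfolding fixed_point_def by blast
    then show False using J.IKC_restricted by simp
  qed
  ultimately show ?thesis by blast
qed

end
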